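(* Let $d\geq 5$ be an odd squarefree integer, let $d'=\varphi(d)/2$, and let $n$ be an integer with $0\leq n\leq d'$. Put $$F_{d,n}=\max\left(\{\varphi(f)/2 : f\mid d,\ 1<f\leq n\}\cup\{|1+\sqrt{D}|/2\}\right).$$ Then $$\left|a_{d,n}+b_{d,n}\sqrt{D}\right|<\min\left\{\sqrt{\frac{2e^{1/(6(F_{d,n}+n))}}{e\pi n}}\left(\frac{e(F_{d,n}+n-1)}{F_{d,n}-1}\right)^{F_{d,n}-\frac12},\ \sqrt{\frac{2e^{1/(6(F_{d,n}+n))}}{e\pi(F_{d,n}-1)}}\left(\frac{e(F_{d,n}+n-1)}{n}\right)^{n+\frac12},\ 2^{F_{d,n}+n}\right\},$$ where for $n=0$ the first two entries of the minimum (which involve division by $n$) are interpreted as $+\infty$.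
   Context: Here $\varphi$ is the Euler totient function and, for an odd squarefree integer $d\ge 5$, $D=(-1)^{(d-1)/2}d$, with $\sqrt{D}=\sqrt{d}$ if $d\equiv 1\pmod 4$ and $\sqrt{D}=i\sqrt{d}$ if $d\equiv 3\pmod 4$; $|\cdot|$ is the complex absolute value. With $(\cdot/d)$ the Jacobi symbol, put $$U_d^{\pm}(X)=\prod_{1\leq k\leq d,\ (k/d)=\pm1}\left(X-e^{2\pi i k/d}\right),\quad \Psi_d(X)=U_d^+(X)+U_d^-(X),\quad \Xi_d(X)=\frac{U_d^-(X)-U_d^+(X)}{\sqrt{D}}.$$ These are polynomials with integer coefficients satisfying the Gauss-Kraïtchik formula $4\Phi_d(X)=\Psi_d(X)^2-D\,\Xi_d(X)^2$, where $\Phi_d$ is the $d$-th cyclotomic polynomial; $\Psi_d$ has degree $d'=\varphi(d)/2$ and $\Xi_d$ has degree $d'-1$. Their coefficients are denoted by $$\Psi_d(X)=\sum_{n=0}^{d'}a_{d,n}X^{d'-n},\qquad \Xi_d(X)=\sum_{n=1}^{d'}b_{d,n}X^{d'-n},$$ and $b_{d,0}=0$. *)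

theory Defs
  imports
    "HOL-Analysis.Analysis"
    "HOL-Number_Theory.Number_Theory"
    "HOL-Computational_Algebra.Computational_Algebra"
begin

(* Intended for odd n only: Legendre a 2 is not the Kronecker symbol. *)
definition jacobi :: "int \<Rightarrow> nat \<Rightarrow> int" where
  "jacobi a n = (\<Prod>p\<in>#prime_factorization n. Legendre a (int p))"

definition disc :: "nat \<Rightarrow> int" where
  "disc d = (- 1) ^ ((d - 1) div 2) * int d"

definition sqrt_disc :: "nat \<Rightarrow> complex" where
  "sqrt_disc d = (if d mod 4 = 1 then of_real (sqrt (real d)) else \<i> * of_real (sqrt (real d)))"

lemma sqrt_disc_squared:
  assumes "odd d"
  shows "sqrt_disc d ^ 2 = of_int (disc d)"
proof -
  from assms have "d mod 4 = 1 \<or> d mod 4 = 3"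
    by presburger
  then show ?thesis
  proof
    assume d: "d mod 4 = 1"
    then have "even ((d - 1) div 2)"
      by presburger
    with d show ?thesis
      by (simp add: sqrt_disc_def disc_def flip: of_real_power)
  next
    assume d: "d mod 4 = 3"
    then have "odd ((d - 1) div 2)"
      by presburger
    with d show ?thesis
      by (simp add: sqrt_disc_def disc_def power_mult_distrib flip: of_real_power)
  qed
qed

(* The sign argument s is 1 or -1, giving the two polynomials U_d^+ and U_d^-. *)
definition U_poly :: "int \<Rightarrow> nat \<Rightarrow> complex poly" where
  "U_poly s d =
     (\<Prod>k | k \<in> {1..d} \<and> jacobi (int k) d = s. [:- exp (2 * of_real pi * \<i> * of_nat k / of_nat d), 1:])"

definition Psi_poly :: "nat \<Rightarrow> complex poly" where
  "Psi_poly d = U_poly 1 d + U_poly (- 1) d"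

definition Xi_poly :: "nat \<Rightarrow> complex poly" where
  "Xi_poly d = Polynomial.smult (1 / sqrt_disc d) (U_poly (- 1) d - U_poly 1 d)"

definition half_totient :: "nat \<Rightarrow> nat" where
  "half_totient d = totient d div 2"

(* The coefficients are integers; they are kept as complex numbers, the type of the
   coefficients of the polynomials. Both are meant for n \<le> half_totient d. *)
definition a_coeff :: "nat \<Rightarrow> nat \<Rightarrow> complex" where
  "a_coeff d n = Polynomial.coeff (Psi_poly d) (half_totient d - n)"

definition b_coeff :: "nat \<Rightarrow> nat \<Rightarrow> complex" where
  "b_coeff d n = (if n = 0 then 0 else Polynomial.coeff (Xi_poly d) (half_totient d - n))"

definition F_max :: "nat \<Rightarrow> nat \<Rightarrow> real" where
  "F_max d n = Max ({real (totient f) / 2 | f. f dvd d \<and> 1 < f \<and> f \<le> n} \<union> {cmod (1 + sqrt_disc d) / 2})"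

end

theory Submission
  imports Defs
begin

text \<open>
  Since \<open>a\<^bsub>d,n\<^esub> + b\<^bsub>d,n\<^esub> \<surd>D\<close> is twice the coefficient of \<open>X\<close> to the power \<open>d' - n\<close> in \<open>U\<^sub>d\<^sup>-\<close>, it is, up to sign,
  twice the \<open>n\<close>-th elementary symmetric function of the roots. The \<open>m\<close>-th power sum of these
  roots is half the difference of a Ramanujan sum, equal to \<open>\<plusminus>\<phi>(gcd d m)\<close>, and a Gauss sum,
  equal to \<open>\<plusminus>\<surd>D\<close> if \<open>gcd d m = 1\<close> and to \<open>0\<close> otherwise; the sign of the Gauss sum is irrelevant.
  So for \<open>1 \<le> m \<le> n\<close> the power sums are bounded by \<open>F\<close>, and Newton's identities, compared with
  the expansion of \<open>(1 - x)\<close> to the power \<open>-F\<close>, bound the symmetric function by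
  \<open>F(F+1)\<dots>(F+n-1)/n!\<close>. Stirling's formula then gives the first two bounds, and Pascal's rule the
  third.
\<close>

section \<open>Bounds for generalised binomial coefficients\<close>

text \<open>With g(x) = (x + 1/2) ln x - x, the increment g(x + 1) - g(x) equals ln(x + 1) + (x +
  1/2)(ln(x + 1) - ln x) - 1. The midpoint estimate ln(x + 1) - ln x \<ge> 2/(2x + 1) for the
  integral of 1/t makes the last two terms nonnegative.\<close>

lemma ln_add_one_le_stirling_diff:
  fixes x :: real
  assumes "x > 0"
  shows "ln (x + 1) \<le> ((x + 1 + 1/2) * ln (x + 1) - (x + 1)) - ((x + 1/2) * ln x - x)"
proof -
  have "(x + 1/2) * (2 * (x + 1 - x) / (x + (x + 1))) \<le> (x + 1/2) * (ln (x + 1) - ln x)"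
    using assms by (intro mult_left_mono ln_inverse_approx_ge) auto
  moreover have "(x + 1/2) * (2 * (x + 1 - x) / (x + (x + 1))) = 1"
    using assms by (simp add: field_simps)
  ultimately show ?thesis
    by (simp add: algebra_simps)
qed

text \<open>The trapezoid rule overestimates the integral of 1/t, and (x + 1/2) times its value is 1
  + 1/(4x(x + 1)). Written as a difference, this error telescopes.\<close>

lemma stirling_diff_le:
  fixes x :: real
  assumes "x > 0"
  shows "((x + 1 + 1/2) * ln (x + 1) - (x + 1)) - ((x + 1/2) * ln x - x)
           \<le> ln (x + 1) + 1 / (4 * x) - 1 / (4 * (x + 1))"
proof -
  have "(x + 1/2) * (ln (x + 1) - ln x) \<le> (x + 1/2) * (1 * (inverse x + inverse (x + 1)) / 2)"
    using assms by (intro mult_left_mono ln_inverse_approx_le) auto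
  also have "\<dots> = 1 + 1 / (4 * x) - 1 / (4 * (x + 1))"
    using assms by (simp add: divide_simps) (simp add: algebra_simps)
  finally show ?thesis
    by (simp add: algebra_simps)
qed

text \<open>Closed form of the Wallis product in factorials; the limit pi/2 of that product then
  determines the constant in Stirling's formula.\<close>

lemma wallis_prod_eq:
  "(\<Prod>k=1..n. (4 * real k^2) / (4 * real k^2 - 1)) =
     (4 ^ n * fact n ^ 2 / fact (2 * n))^2 / (2 * real n + 1)"
proof (induction n)
  case (Suc n)
  define x where "x = real n"
  have x: "x \<ge> 0" "real (Suc n) = x + 1"
    by (auto simp: x_def)
  have "(fact (2 * Suc n) :: real) = (2 * x + 2) * (2 * x + 1) * fact (2 * n)"
    "(fact (Suc n) :: real) = (x + 1) * fact n"
    by (simp_all add: algebra_simps x_def)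
  then have "4 ^ Suc n * fact (Suc n) ^ 2 / fact (2 * Suc n) =
      (4 ^ n * fact n ^ 2 / fact (2 * n)) * ((2 * x + 2) / (2 * x + 1))"
    using x by (simp add: divide_simps power2_eq_square del: of_nat_Suc fact_Suc) (simp add: algebra_simps)
  moreover have "4 * real (Suc n)^2 - 1 = (2 * x + 1) * (2 * x + 3)" "4 * real (Suc n)^2 = (2 * x + 2)^2"
    unfolding x by (simp_all add: algebra_simps power2_eq_square)
  moreover have "2 * real (Suc n) + 1 = 2 * x + 3"
    by (simp add: x_def)
  moreover have "(y * (u / v))^2 / w = y^2 / v * (u^2 / (v * w))" for y u v w :: real
    by (simp add: power2_eq_square mult_ac)
  ultimately have
    "(4 ^ Suc n * fact (Suc n) ^ 2 / fact (2 * Suc n))^2 / (2 * real (Suc n) + 1) =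
       (4 ^ n * fact n ^ 2 / fact (2 * n))^2 / (2 * x + 1) * (4 * real (Suc n)^2 / (4 * real (Suc n)^2 - 1))"
    by (simp only:)
  then show ?case
    using Suc by (simp only: prod.nat_ivl_Suc' x_def mult.commute)
qed auto

text \<open>The error \<open>s n\<close> of the approximation decreases while
  \<open>s n - 1 / (4 * real n)\<close> increases, so \<open>s\<close> converges to some
  \<open>c\<close> from above. In 2(2s(n) - s(2n)), which tends to 2c, everything cancels except the
  logarithm of a Wallis product, whence c = ln(2 pi)/2.\<close>

lemma ln_fact_ge_stirling:
  assumes "n > 0"
  shows "ln (fact n) \<ge> (real n + 1/2) * ln (real n) - real n + ln (2 * pi) / 2"
proof -
  define s where "s = (\<lambda>n::nat. ln (fact n) - ((real n + 1/2) * ln (real n) - real n))"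
  have s_Suc: "s (Suc n) \<le> s n" "s n - 1 / (4 * real n) \<le> s (Suc n) - 1 / (4 * real (Suc n))"
    if "n > 0" for n
  proof -
    have "ln (fact (Suc n) :: real) = ln (real n + 1) + ln (fact n)"
      using ln_mult_pos[of "real n + 1" "fact n"] by (simp add: algebra_simps)
    then show "s (Suc n) \<le> s n" "s n - 1 / (4 * real n) \<le> s (Suc n) - 1 / (4 * real (Suc n))"
      using ln_add_one_le_stirling_diff[of "real n"] stirling_diff_le[of "real n"] that
      unfolding s_def of_nat_Suc add.commute[of 1 "real n"] by linarith+
  qed
  have dec: "decseq (\<lambda>n. s (Suc n))"
    by (rule decseq_SucI, rule s_Suc) simp
  have inc: "incseq (\<lambda>n. s (Suc n) - 1 / (4 * real (Suc n)))"
    by (rule incseq_SucI, rule s_Suc) simp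
  have "s 1 - 1/4 \<le> s (Suc n)" for n
  proof -
    have "s (Suc 0) - 1 / (4 * real (Suc 0)) \<le> s (Suc n) - 1 / (4 * real (Suc n))"
      using inc by (rule incseqD) simp
    also have "\<dots> \<le> s (Suc n)"
      by simp
    finally show ?thesis
      by simp
  qed
  then have bound: "\<forall>n. s 1 - 1/4 \<le> s (Suc n)" ..
  obtain c where c: "(\<lambda>n. s (Suc n)) \<longlonglongrightarrow> c" and c_le: "\<forall>n. c \<le> s (Suc n)"
    by (rule decseq_convergent[OF dec bound])
  have lim: "s \<longlonglongrightarrow> c"
    using c by (rule LIMSEQ_imp_Suc)
  moreover have "(\<lambda>n. s (2 * n)) \<longlonglongrightarrow> c"
    using lim by (rule filterlim_compose) (simp add: mult_nat_left_at_top)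
  ultimately have "(\<lambda>n. 2 * (2 * s n - s (2 * n))) \<longlonglongrightarrow> 2 * (2 * c - c)"
    by (intro tendsto_intros)
  \<comment> \<open>The factor 4 + 2/n = 2(2n + 1)/n cancels the denominator 2n + 1 of the closed
    Wallis product, and it tends to 4.\<close>
  moreover have "2 * (2 * s n - s (2 * n)) =
      ln ((\<Prod>k=1..n. (4 * real k^2) / (4 * real k^2 - 1)) * (4 + 2 / real n))" if "n > 0" for n
  proof -
    have "(4 + 2 / real n) = (2 * real n + 1) * 2 / real n"
      using that by (simp add: field_simps)
    moreover have "x / (2 * real n + 1) * ((2 * real n + 1) * 2 / real n) = x * 2 / real n" for x
    proof -
      have "2 * real n + 1 \<noteq> 0"
        by linarith
      then show ?thesis
        by (metis (no_types, opaque_lifting) divide_divide_eq_left' mult.commute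
            nonzero_mult_div_cancel_left times_divide_eq_left times_divide_eq_right)
    qed
    ultimately have "ln ((\<Prod>k=1..n. (4 * real k^2) / (4 * real k^2 - 1)) * (4 + 2 / real n))
       = ln ((4 ^ n * fact n ^ 2 / fact (2 * n))^2 * 2 / real n)"
      by (simp only: wallis_prod_eq)
    also have "\<dots> = 2 * (real n * ln 4 + 2 * ln (fact n) - ln (fact (2 * n))) + ln 2 - ln (real n)"
      using that by (simp add: ln_div ln_mult_pos ln_realpow)
    also have "ln 4 = 2 * ln (2::real)"
      using ln_realpow[of 2 2] by simp
    also have "2 * (real n * (2 * ln 2) + 2 * ln (fact n) - ln (fact (2 * n))) + ln 2 - ln (real n) =
        2 * (2 * s n - s (2 * n))"
      using that by (simp add: s_def ln_mult_pos field_simps)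
    finally show ?thesis ..
  qed
  then have "eventually (\<lambda>n. 2 * (2 * s n - s (2 * n)) =
      ln ((\<Prod>k=1..n. (4 * real k^2) / (4 * real k^2 - 1)) * (4 + 2 / real n))) sequentially"
    using eventually_gt_at_top[of 0] by (rule eventually_mono[rotated])
  ultimately have "(\<lambda>n. ln ((\<Prod>k=1..n. (4 * real k^2) / (4 * real k^2 - 1)) * (4 + 2 / real n)))
     \<longlonglongrightarrow> 2 * (2 * c - c)"
    by (rule Lim_transform_eventually)
  moreover have "(\<lambda>n. ln ((\<Prod>k=1..n. (4 * real k^2) / (4 * real k^2 - 1)) * (4 + 2 / real n)))
     \<longlonglongrightarrow> ln (pi / 2 * (4 + 0))"
    by (rule tendsto_ln, rule tendsto_mult[OF wallis], rule tendsto_add[OF tendsto_const],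
        rule lim_const_over_n) simp
  ultimately have "2 * (2 * c - c) = ln (pi / 2 * (4 + 0))"
    by (rule LIMSEQ_unique)
  moreover have "pi / 2 * (4 + 0) = 2 * pi"
    by simp
  ultimately have "c = ln (2 * pi) / 2"
    by (metis add_diff_cancel_left' mult_2 nonzero_mult_div_cancel_left zero_neq_numeral)
  moreover have "c \<le> s n"
    using spec[OF c_le, of "n - 1"] assms by simp
  ultimately show ?thesis
    unfolding s_def by linarith
qed

section \<open>Stirling-type bounds for \<open>pochhammer (G + 1) n / fact n\<close>\<close>

text \<open>The left side is the sum of ln(G + k) over k = 1, ..., n. Each term is at most an
  increment of (x + 1/2) ln x - x, and these increments telescope.\<close>

lemma ln_pochhammer_le_stirling:
  fixes G :: real
  assumes "G > 0"
  shows "ln (pochhammer (G + 1) n) \<le>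
    ((G + real n + 1/2) * ln (G + real n) - (G + real n)) - ((G + 1/2) * ln G - G)"
proof (induction n)
  case (Suc n)
  have "ln (pochhammer (G + 1) (Suc n)) = ln (pochhammer (G + 1) n) + ln (G + real n + 1)"
    using assms by (subst pochhammer_Suc, subst ln_mult_pos) (auto intro!: pochhammer_pos simp: add_ac)
  then show ?case
    using Suc ln_add_one_le_stirling_diff[of "G + real n"] assms by (simp add: add_ac)
qed auto

lemma ln_pochhammer_over_fact_le:
  fixes G :: real
  assumes "G > 0" "n > 0"
  shows "ln (pochhammer (G + 1) n / fact n) \<le>
    (G + real n + 1/2) * ln (G + real n) - (G + 1/2) * ln G - (real n + 1/2) * ln (real n) - ln (2 * pi) / 2"
proof -
  have "ln (pochhammer (G + 1) n / fact n) = ln (pochhammer (G + 1) n) - ln (fact n)"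
    using assms pochhammer_pos[of "G + 1" n] by (simp add: ln_divide_pos)
  then show ?thesis
    using ln_pochhammer_le_stirling[OF assms(1), of n] ln_fact_ge_stirling[OF assms(2)] by linarith
qed

lemma ln_ratio_less:
  fixes x y :: real
  assumes "x > 0" "y > 0"
  shows "x * (ln (x + y) - ln x) < y"
proof -
  have "ln (x + y) - ln x = ln (1 + y / x)"
    using assms by (subst ln_divide_pos [symmetric]) (auto simp: add_divide_distrib)
  also have "\<dots> < y / x"
    using assms by (intro ln_add_one_self_less_self) auto
  finally show ?thesis
    using assms by (simp add: field_simps)
qed

text \<open>The Stirling estimate is symmetric in \<open>G\<close> and \<open>real n\<close>, so
  leaving open which of them is \<open>x\<close> and which is \<open>y\<close> covers the first two
  bounds of the theorem at once.\<close>

lemma pochhammer_over_fact_less_stirling: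
  fixes x y :: real
  assumes "G > 0" "n > 0" "{x, y} = {G, real n}" "E > 0"
  shows "2 * (pochhammer (G + 1) n / fact n) <
    sqrt (2 * exp E / (exp 1 * pi * x)) * (exp 1 * (G + real n) / y) powr (y + 1/2)"
proof -
  have pos: "x > 0" "y > 0" and xy: "G + real n = x + y"
    "(G + 1/2) * ln G + (real n + 1/2) * ln (real n) = (x + 1/2) * ln x + (y + 1/2) * ln y"
    using assms by (auto simp: doubleton_eq_iff)
  have B: "pochhammer (G + 1) n / fact n > 0"
    using assms by (intro divide_pos_pos pochhammer_pos) auto
  have "ln (2 * (pochhammer (G + 1) n / fact n)) = ln 2 + ln (pochhammer (G + 1) n / fact n)"
    using B by (intro ln_mult_pos) auto
  also have "\<dots> \<le> ln 2 + ((x + y + 1/2) * ln (x + y) - (x + 1/2) * ln x - (y + 1/2) * ln y - ln (2 * pi) / 2)"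
    using ln_pochhammer_over_fact_le[OF assms(1,2)] xy by simp
  \<comment> \<open>Here x(ln(x + y) - ln x) is replaced by y. The 1 in the factor 1 + ln(x + y) -
    ln y contributes y + 1/2, and the surplus 1/2 is taken back by the factor \<open>exp 1\<close>
    under the square root.\<close>
  also have "\<dots> < (ln 2 + E - 1 - ln pi - ln x) / 2 + (y + 1/2) * (1 + ln (x + y) - ln y)"
    using ln_ratio_less[OF pos] assms(4) by (simp add: ln_mult_pos field_simps)
  also have "\<dots> = ln (sqrt (2 * exp E / (exp 1 * pi * x)) * (exp 1 * (x + y) / y) powr (y + 1/2))"
    using pos
    by (subst ln_mult_pos)
      (simp_all add: ln_mult_pos ln_divide_pos ln_sqrt)
  finally show ?thesis
    unfolding xy(1) using B pos by (subst (asm) ln_less_cancel_iff) simp_all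
qed

section \<open>The bound by a power of two\<close>

text \<open>Pascal's rule: \<open>pochhammer (x + 1) n / fact n\<close> is the generalised binomial
  coefficient "x + n choose n".\<close>

lemma pochhammer_over_fact_rec:
  fixes x :: "'a :: field_char_0"
  shows "pochhammer (x + 1) (Suc n) / fact (Suc n) =
    pochhammer x (Suc n) / fact (Suc n) + pochhammer (x + 1) n / fact n"
proof -
  have "pochhammer (x + 1) (Suc n) = pochhammer x (Suc n) + of_nat (Suc n) * pochhammer (x + 1) n"
    by (subst (1) pochhammer_rec', subst (1) pochhammer_rec) (simp add: algebra_simps)
  then show ?thesis
    by (simp add: add_divide_distrib del: of_nat_Suc)
qed

text \<open>For x \<le> 2 the quotient of consecutive terms, (x + n)/(n + 1), is at most 2, so the
  n-th term is at most 2^n; strictness comes from x > 1. This strip starts the induction on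
  \<open>x\<close>.\<close>

lemma pochhammer_over_fact_less_power_small:
  fixes x :: real
  assumes "1 < x" "x \<le> 2"
  shows "pochhammer x n / fact n < 2 powr (x + real n - 1)"
proof -
  have "pochhammer x n / fact n \<le> 2 ^ n"
  proof (induction n)
    case (Suc n)
    have "pochhammer x (Suc n) / fact (Suc n) = pochhammer x n / fact n * ((x + real n) / real (Suc n))"
      by (simp add: pochhammer_Suc field_simps)
    also have "\<dots> \<le> 2 ^ n * 2"
      using assms Suc by (intro mult_mono) (auto simp: field_simps)
    finally show ?case
      by simp
  qed auto
  also have "\<dots> = 2 powr real n"
    by (simp add: powr_realpow)
  also have "\<dots> < 2 powr (x + real n - 1)"
    using assms by simp
  finally show ?thesis .
qed

lemma pochhammer_over_fact_less_power:
  fixes x :: real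
  assumes "1 < x"
  shows "pochhammer x n / fact n < 2 powr (x + real n - 1)"
proof -
  \<comment> \<open>The integer \<open>k\<close> turns the descent from \<open>x\<close> to
    \<open>x - 1\<close> into an induction that ends in the strip 1 < x \<le> 2.\<close>
  have *: "pochhammer x n / fact n < 2 powr (x + real n - 1)"
    if "1 < x" "x \<le> real k + 2" for x k
    using that
  proof (induction k arbitrary: x n)
    case 0
    then show ?case
      using pochhammer_over_fact_less_power_small by simp
  next
    case (Suc k)
    note outer = Suc.IH and prems = Suc.prems
    show ?case
    proof (cases "x \<le> 2")
      case False
      show ?thesis
      proof (induction n)
        case 0
        show ?case
          using prems by simp
      next
        case (Suc n)
        \<comment> \<open>Both terms of Pascal's rule have the same bound
          \<open>2 powr (x + real n - 1)\<close>, half of the one wanted.\<close>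
        have "pochhammer (x - 1) (Suc n) / fact (Suc n) < 2 powr ((x - 1) + real (Suc n) - 1)"
          using False prems by (intro outer) auto
        moreover have "2 powr (x + real (Suc n) - 1) = 2 * 2 powr (x + real n - 1)"
          by (simp add: powr_diff powr_add)
        ultimately show ?case
          using Suc pochhammer_over_fact_rec[of "x - 1" n] by (simp add: algebra_simps)
      qed
    qed (use prems in \<open>simp add: pochhammer_over_fact_less_power_small\<close>)
  qed
  obtain k :: nat where "x - 2 \<le> real k"
    using real_arch_simple by blast
  then show ?thesis
    using assms by (intro *[of x k]) auto
qed

section \<open>Coefficients and power sums\<close>

text \<open>This is the logarithmic derivative of the product, cleared of denominators: r/(1 - rX)
  expands to the series with coefficients r^(n+1), and summing over the factors gives the power
  sums.\<close>

lemma fps_deriv_prod_linear_factors: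
  fixes r :: "'b \<Rightarrow> 'a :: field"
  assumes "finite A"
  shows "fps_deriv (\<Prod>k\<in>A. 1 - fps_const (r k) * fps_X) =
    - (\<Prod>k\<in>A. 1 - fps_const (r k) * fps_X) * Abs_fps (\<lambda>n. \<Sum>k\<in>A. r k ^ Suc n)"
  using assms
proof (induction A)
  case empty
  have "Abs_fps (\<lambda>n. \<Sum>k\<in>{}. r k ^ Suc n) = 0"
    by (simp add: fps_eq_iff)
  then show ?case
    by simp
next
  case (insert x A)
  let ?P = "\<Prod>k\<in>A. 1 - fps_const (r k) * fps_X"
  let ?S = "Abs_fps (\<lambda>n. \<Sum>k\<in>A. r k ^ Suc n)" and ?R = "Abs_fps (\<lambda>n. r x ^ Suc n)"
  have "(1 - fps_const (r x) * fps_X) * ?R = fps_const (r x)"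
    by (auto simp: fps_eq_iff algebra_simps power_eq_if)
  moreover have "Abs_fps (\<lambda>n. \<Sum>k\<in>insert x A. r k ^ Suc n) = ?R + ?S"
    using insert by (simp add: fps_eq_iff)
  moreover have "(\<Prod>k\<in>insert x A. 1 - fps_const (r k) * fps_X) = (1 - fps_const (r x) * fps_X) * ?P"
    using insert by simp
  moreover have "fps_deriv ((1 - fps_const (r x) * fps_X) * ?P) =
      - (fps_const (r x) * ?P) - (1 - fps_const (r x) * fps_X) * ?P * ?S"
    using insert by (simp add: algebra_simps)
  moreover have "- (L * P) * (R + S) = - ((L * R) * P) - L * P * S" for L P R S :: "'a fps"
    by (simp add: algebra_simps)
  ultimately show ?case
    by (simp only:)
qed

text \<open>Compares the coefficients of X^n in the preceding identity.\<close>

lemma newton_identity: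
  fixes r :: "'b \<Rightarrow> 'a :: field"
  assumes "finite A"
  defines "P \<equiv> \<Prod>k\<in>A. [:1, - r k:]"
  shows "of_nat (Suc n) * poly.coeff P (Suc n) =
    - (\<Sum>i\<le>n. poly.coeff P i * (\<Sum>k\<in>A. r k ^ Suc (n - i)))"
proof -
  define Q where "Q = (\<Prod>k\<in>A. 1 - fps_const (r k) * fps_X)"
  have "fps_of_poly P = Q"
    by (simp add: P_def Q_def fps_of_poly_prod fps_of_poly_linear' flip: fps_const_neg)
  then have nth: "Q $ i = poly.coeff P i" for i
    by (metis fps_of_poly_nth)
  have "fps_deriv Q $ n = (- Q * Abs_fps (\<lambda>n. \<Sum>k\<in>A. r k ^ Suc n)) $ n"
    unfolding Q_def by (subst fps_deriv_prod_linear_factors[OF assms(1)]) (rule refl)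
  then show ?thesis
    by (simp add: fps_mult_nth nth atMost_atLeast0 sum_negf)
qed

text \<open>The quotients are the coefficients of (1 - X)^(-x), and the claim is its differential
  equation. It is Newton's recursion with every power sum replaced by \<open>-x\<close> in place of
  the sign, hence the extremal case of the next estimate.\<close>

lemma sum_pochhammer_over_fact:
  fixes x :: "'a :: field_char_0"
  shows "x * (\<Sum>i\<le>n. pochhammer x i / fact i) = of_nat (Suc n) * (pochhammer x (Suc n) / fact (Suc n))"
proof (induction n)
  case (Suc n)
  have *: "of_nat (Suc k) * (pochhammer x (Suc k) / fact (Suc k)) = (x + of_nat k) * (pochhammer x k / fact k)" for k
    by (simp add: pochhammer_Suc field_simps del: of_nat_Suc)
  have "x * (\<Sum>i\<le>Suc n. pochhammer x i / fact i) =
      of_nat (Suc n) * (pochhammer x (Suc n) / fact (Suc n)) + x * (pochhammer x (Suc n) / fact (Suc n))"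
    by (simp only: sum.atMost_Suc distrib_left Suc)
  also have "\<dots> = (x + of_nat (Suc n)) * (pochhammer x (Suc n) / fact (Suc n))"
    by (simp only: algebra_simps)
  also have "\<dots> = of_nat (Suc (Suc n)) * (pochhammer x (Suc (Suc n)) / fact (Suc (Suc n)))"
    by (rule *[symmetric])
  finally show ?case .
qed auto

text \<open>Taking norms in Newton's identity gives a recursive inequality; the recursion with
  equality, starting at 1, is solved by \<open>pochhammer F n / fact n\<close>.\<close>

lemma norm_coeff_le_of_power_sum_le:
  fixes r :: "'b \<Rightarrow> 'a :: real_normed_field"
  assumes "finite A" and F: "\<And>m. 1 \<le> m \<Longrightarrow> m \<le> n \<Longrightarrow> norm (\<Sum>k\<in>A. r k ^ m) \<le> F"
  shows "norm (poly.coeff (\<Prod>k\<in>A. [:1, - r k:]) n) \<le> pochhammer F n / fact n"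
  using F
proof (induction n rule: less_induct)
  case (less n)
  let ?P = "\<Prod>k\<in>A. [:1, - r k:]"
  show ?case
  proof (cases n)
    case 0
    have "poly.coeff ?P 0 = 1"
      by (simp add: poly_0_coeff_0[symmetric] poly_prod)
    then show ?thesis
      using 0 by simp
  next
    case (Suc m)
    have "real (Suc m) * norm (poly.coeff ?P (Suc m)) = norm (of_nat (Suc m) * poly.coeff ?P (Suc m))"
      by (simp only: norm_mult norm_of_nat)
    also have "\<dots> = norm (\<Sum>i\<le>m. poly.coeff ?P i * (\<Sum>k\<in>A. r k ^ Suc (m - i)))"
      by (simp only: newton_identity[OF assms(1)] norm_minus_cancel)
    also have "\<dots> \<le> (\<Sum>i\<le>m. norm (poly.coeff ?P i) * norm (\<Sum>k\<in>A. r k ^ Suc (m - i)))"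
      by (rule order.trans[OF norm_sum]) (simp only: norm_mult order.refl)
    also have "\<dots> \<le> (\<Sum>i\<le>m. pochhammer F i / fact i * F)"
    proof (intro sum_mono mult_mono)
      fix i assume i: "i \<in> {..m}"
      show "norm (poly.coeff ?P i) \<le> pochhammer F i / fact i"
        using i Suc less.prems by (intro less.IH) auto
      then show "0 \<le> pochhammer F i / fact i"
        by (rule order.trans[OF norm_ge_zero])
      show "norm (\<Sum>k\<in>A. r k ^ Suc (m - i)) \<le> F"
        using i Suc by (intro less.prems) auto
    qed auto
    also have "\<dots> = F * (\<Sum>i\<le>m. pochhammer F i / fact i)"
      by (simp only: sum_distrib_left mult.commute)
    also have "\<dots> = real (Suc m) * (pochhammer F (Suc m) / fact (Suc m))"
      by (rule sum_pochhammer_over_fact)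
    finally show ?thesis
      unfolding Suc by (subst (asm) mult_le_cancel_left_pos) (simp_all del: pochhammer_Suc)
  qed
qed

text \<open>Reversing the coefficients of a product of factors X - r gives the product of the
  factors 1 - rX.\<close>

lemma coeff_prod_linear_eq_coeff_reflected:
  fixes r :: "'b \<Rightarrow> 'a :: field"
  assumes "finite A" "n \<le> card A"
  shows "poly.coeff (\<Prod>k\<in>A. [:- r k, 1:]) (card A - n) = poly.coeff (\<Prod>k\<in>A. [:1, - r k:]) n"
proof -
  have deg: "degree (\<Prod>k\<in>A. [:- r k, 1:]) = card A"
    by (subst degree_prod_eq_sum_degree) auto
  have "reflect_poly [:- r k, 1:] = [:1, - r k:]" for k
    by (simp add: reflect_poly_pCons' monom_Suc monom_0)
  then have "(\<Prod>k\<in>A. [:1, - r k:]) = reflect_poly (\<Prod>k\<in>A. [:- r k, 1:])"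
    by (simp add: reflect_poly_prod)
  then show ?thesis
    using assms deg by (simp add: coeff_reflect_poly)
qed

section \<open>Exponential sums\<close>

definition unity_exp :: "nat \<Rightarrow> nat \<Rightarrow> complex" where
  "unity_exp d k = cis (2 * pi * real k / real d)"

lemma unity_exp_add: "unity_exp d (j + k) = unity_exp d j * unity_exp d k"
  by (simp add: unity_exp_def cis_mult add_divide_distrib distrib_left)

lemma unity_exp_power: "unity_exp d k ^ m = unity_exp d (k * m)"
  by (simp only: unity_exp_def Complex.DeMoivre of_nat_mult) (simp add: mult_ac)

lemma unity_exp_0 [simp]: "unity_exp d 0 = 1"
  by (simp add: unity_exp_def)

lemma unity_exp_multiple [simp]:
  assumes "d > 0"
  shows "unity_exp d (d * k) = 1"
proof -
  have "unity_exp d (d * k) = cis (2 * pi * real k)"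
    using assms by (simp add: unity_exp_def mult.assoc)
  then show ?thesis
    by (simp add: cis_multiple_2pi del: mult.assoc)
qed

lemma unity_exp_cancel:
  assumes "b > 0"
  shows "unity_exp (a * b) (k * b) = unity_exp a k"
  using assms by (simp add: unity_exp_def mult.assoc)

lemma unity_exp_cong:
  assumes "d > 0" "[j = k] (mod d)"
  shows "unity_exp d j = unity_exp d k"
proof -
  have "unity_exp d k = unity_exp d (k mod d)" for k
    using unity_exp_add[of d "d * (k div d)" "k mod d"] assms(1) by simp
  then show ?thesis
    using assms(2) unfolding cong_def by metis
qed

lemma unity_exp_eq_1_iff:
  assumes "d > 0"
  shows "unity_exp d k = 1 \<longleftrightarrow> d dvd k"
  using complex_root_unity_eq_1[of d k] assms
  by (simp add: unity_exp_def cis_conv_exp mult_ac)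

lemma sum_unity_exp:
  assumes "d > 0"
  shows "(\<Sum>k<d. unity_exp d (k * m)) = (if d dvd m then of_nat d else 0)"
proof (cases "d dvd m")
  case True
  then have "unity_exp d (k * m) = 1" for k
    using assms by (simp add: unity_exp_eq_1_iff)
  then show ?thesis
    using True by simp
next
  case False
  have "unity_exp d m \<noteq> 1"
    using False assms by (simp add: unity_exp_eq_1_iff)
  moreover have "unity_exp d m ^ d = 1"
    using assms by (simp add: unity_exp_power mult.commute)
  ultimately have "(\<Sum>k<d. unity_exp d m ^ k) = 0"
    by (simp add: geometric_sum)
  then show ?thesis
    using False by (simp add: unity_exp_power mult.commute)
qed

text \<open>The discrete Fourier transform of \<open>f\<close> at frequency \<open>m\<close>. Jacobi
  symbols give Gauss sums, their squares give Ramanujan sums.\<close>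

definition twisted_sum :: "(nat \<Rightarrow> complex) \<Rightarrow> nat \<Rightarrow> nat \<Rightarrow> complex" where
  "twisted_sum f d m = (\<Sum>k<d. f k * unity_exp d (k * m))"

lemma bij_betw_mult_mod:
  fixes a d :: nat
  assumes "coprime a d" "d > 0"
  shows "bij_betw (\<lambda>k. a * k mod d) {..<d} {..<d}"
proof -
  have "inj_on (\<lambda>k. a * k mod d) {..<d}"
  proof (rule inj_onI)
    fix j k assume *: "j \<in> {..<d}" "k \<in> {..<d}" "a * j mod d = a * k mod d"
    then have "[j = k] (mod d)"
      using assms cong_mult_lcancel_nat[of a d j k] by (simp add: cong_def)
    then show "j = k"
      using * by (simp add: cong_def)
  qed
  moreover have "(\<lambda>k. a * k mod d) ` {..<d} \<subseteq> {..<d}"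
    using assms by auto
  ultimately show ?thesis
    by (simp add: bij_betw_def endo_inj_surj)
qed

lemma twisted_sum_reindex_mult:
  assumes "coprime a d" "d > 0" and per: "\<And>k. f (k mod d) = f k"
  shows "twisted_sum f d m = (\<Sum>k<d. f (a * k) * unity_exp d (k * (a * m)))"
proof -
  have "twisted_sum f d m = (\<Sum>k<d. f (a * k mod d) * unity_exp d (a * k mod d * m))"
    unfolding twisted_sum_def
    by (rule sum.reindex_bij_betw[symmetric], rule bij_betw_mult_mod) (fact assms)+
  also have "\<dots> = (\<Sum>k<d. f (a * k) * unity_exp d (k * (a * m)))"
  proof (intro sum.cong refl arg_cong2[of _ _ _ _ "(*)"] per)
    fix k
    have "[a * k mod d * m = k * (a * m)] (mod d)"
      using mod_mult_left_eq[of "a * k" d m] by (simp add: cong_def mult_ac)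
    then show "unity_exp d (a * k mod d * m) = unity_exp d (k * (a * m))"
      using assms(2) by (rule unity_exp_cong[rotated])
  qed
  finally show ?thesis .
qed

text \<open>The Chinese remainder theorem in symmetric form: modulo \<open>a\<close> only i * b
  survives and modulo \<open>b\<close> only j * a, which gives injectivity; both sets have a * b
  elements.\<close>

lemma bij_betw_crt:
  fixes a b :: nat
  assumes "coprime a b" "a > 0" "b > 0"
  shows "bij_betw (\<lambda>(i, j). (i * b + j * a) mod (a * b)) ({..<a} \<times> {..<b}) {..<a * b}"
proof -
  let ?f = "\<lambda>(i, j). (i * b + j * a) mod (a * b)"
  have "coprime b a"
    using assms(1) by (rule coprime_commute[THEN iffD1])
  have inj: "inj_on ?f ({..<a} \<times> {..<b})"
  proof (rule inj_onI, clarify)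
    fix i j i' j'
    assume *: "i < a" "j < b" "i' < a" "j' < b"
      "(i * b + j * a) mod (a * b) = (i' * b + j' * a) mod (a * b)"
    then have cong: "[i * b + j * a = i' * b + j' * a] (mod a * b)"
      by (simp only: cong_def)
    have "[i * b = i' * b] (mod a)"
      using cong_modulus_mult_nat[OF cong] by (simp only: cong_def mod_mult_self1)
    then have "[i = i'] (mod a)"
      by (simp only: cong_mult_rcancel_nat[OF \<open>coprime b a\<close>])
    moreover have "[j * a = j' * a] (mod b)"
      using cong_modulus_mult_nat[OF cong[unfolded mult.commute[of a b]]]
      by (simp only: cong_def mod_mult_self3)
    then have "[j = j'] (mod b)"
      by (simp only: cong_mult_rcancel_nat[OF assms(1)])
    ultimately show "i = i' \<and> j = j'"
      using * by (simp add: cong_def)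
  qed
  have "?f ` ({..<a} \<times> {..<b}) = {..<a * b}"
  proof (rule card_subset_eq)
    show "?f ` ({..<a} \<times> {..<b}) \<subseteq> {..<a * b}"
      using assms by auto
    show "card (?f ` ({..<a} \<times> {..<b})) = card {..<a * b}"
      by (subst card_image[OF inj]) (simp add: card_cartesian_product)
  qed auto
  with inj show ?thesis
    by (simp add: bij_betw_def)
qed

text \<open>Writing k = i * b + j * a splits the exponential as e(km/(ab)) = e(im/a) e(jm/b), where
  e(t) = exp(2 pi i t). The arguments \<open>k * b\<close> and \<open>k * a\<close> are the residues
  of \<open>k\<close> that the two functions see.\<close>

lemma twisted_sum_mult_coprime:
  fixes a b :: nat
  assumes "coprime a b" "a > 0" "b > 0"
    and f: "\<And>j k. [j = k] (mod a) \<Longrightarrow> f j = f k" and g: "\<And>j k. [j = k] (mod b) \<Longrightarrow> g j = g k"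
  shows "twisted_sum (\<lambda>k. f k * g k) (a * b) m =
    twisted_sum (\<lambda>k. f (k * b)) a m * twisted_sum (\<lambda>k. g (k * a)) b m"
proof -
  let ?h = "\<lambda>(i, j). (i * b + j * a) mod (a * b)"
  have "twisted_sum (\<lambda>k. f k * g k) (a * b) m =
      (\<Sum>x\<in>{..<a} \<times> {..<b}. f (?h x) * g (?h x) * unity_exp (a * b) (?h x * m))"
    unfolding twisted_sum_def
    by (rule sum.reindex_bij_betw[symmetric], rule bij_betw_crt) (fact assms)+
  also have "\<dots> = (\<Sum>(i, j)\<in>{..<a} \<times> {..<b}.
      (f (i * b) * unity_exp a (i * m)) * (g (j * a) * unity_exp b (j * m)))"
  proof (intro sum.cong refl, clarify)
    fix i j
    let ?k = "(i * b + j * a) mod (a * b)"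
    have fk: "f ?k = f (i * b)"
      by (rule f) (simp add: cong_def mod_mod_cancel)
    have gk: "g ?k = g (j * a)"
      by (rule g) (simp add: cong_def mod_mod_cancel)
    have "unity_exp (a * b) (?k * m) = unity_exp (a * b) (i * m * b + j * m * a)"
      using assms(2,3) mod_mult_left_eq[of "i * b + j * a" "a * b" m]
      by (intro unity_exp_cong) (auto simp: cong_def algebra_simps)
    also have "\<dots> = unity_exp a (i * m) * unity_exp b (j * m)"
      using unity_exp_cancel[of b a "i * m"] unity_exp_cancel[of a b "j * m"] assms(2,3)
      by (simp only: unity_exp_add mult.commute[of b a])
    finally have uk: "unity_exp (a * b) (?k * m) = unity_exp a (i * m) * unity_exp b (j * m)" .
    show "f ?k * g ?k * unity_exp (a * b) (?k * m) =
      (f (i * b) * unity_exp a (i * m)) * (g (j * a) * unity_exp b (j * m))"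
      unfolding fk gk uk by (simp only: mult_ac)
  qed
  also have "\<dots> = twisted_sum (\<lambda>k. f (k * b)) a m * twisted_sum (\<lambda>k. g (k * a)) b m"
    by (simp add: twisted_sum_def sum_product sum.cartesian_product)
  finally show ?thesis .
qed

section \<open>Legendre and Jacobi symbols\<close>

lemma Legendre_cong:
  assumes "[a = b] (mod p)"
  shows "Legendre a p = Legendre b p"
  using assms by (simp add: Legendre_def QuadRes_def cong_def)

lemma Legendre_cases: "Legendre a p = 0 \<or> Legendre a p = 1 \<or> Legendre a p = -1"
  by (simp add: Legendre_def)

lemma Legendre_eq_0_iff: "Legendre a p = 0 \<longleftrightarrow> p dvd a"
  by (simp add: Legendre_def cong_0_iff)

text \<open>Two numbers in {0, 1, -1} differ by at most 2, which is less than \<open>p\<close>. This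
  turns congruences from Euler's criterion into equalities.\<close>

lemma Legendre_eqI_cong:
  assumes "p > 2" "[Legendre a q = x] (mod p)" "x \<in> {0, 1, -1}"
  shows "Legendre a q = x"
proof -
  have "p dvd Legendre a q - x"
    using assms(2) by (simp add: cong_iff_dvd_diff)
  moreover have "\<bar>Legendre a q - x\<bar> \<le> 2"
    using assms(3) Legendre_cases[of a q] by auto
  ultimately show ?thesis
    using assms(1) zdvd_not_zless[of "\<bar>Legendre a q - x\<bar>" p] by (cases "Legendre a q = x") auto
qed

lemma Legendre_mult:
  assumes "prime p" "p > (2::nat)"
  shows "Legendre (a * b) p = Legendre a p * Legendre b p"
proof (rule Legendre_eqI_cong)
  have "[Legendre (a * b) p = (a * b) ^ ((p - 1) div 2)] (mod int p)"
    using assms by (intro euler_criterion) auto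
  moreover have "[Legendre a p * Legendre b p = a ^ ((p - 1) div 2) * b ^ ((p - 1) div 2)] (mod int p)"
    using assms by (intro cong_mult euler_criterion) auto
  ultimately show "[Legendre (a * b) p = Legendre a p * Legendre b p] (mod int p)"
    by (simp add: cong_def power_mult_distrib)
  show "Legendre a p * Legendre b p \<in> {0, 1, -1}"
    using Legendre_cases[of a p] Legendre_cases[of b p] by auto
qed (use assms in auto)

lemma Legendre_minus_1:
  assumes "prime p" "p > (2::nat)"
  shows "Legendre (-1) p = (-1) ^ ((p - 1) div 2)"
proof (rule Legendre_eqI_cong)
  show "[Legendre (-1) p = (-1) ^ ((p - 1) div 2)] (mod int p)"
    using assms by (intro euler_criterion) auto
  show "(-1) ^ ((p - 1) div 2) \<in> {0, 1, -1 :: int}"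
    by (cases "even ((p - 1) div 2)") auto
qed (use assms in auto)

text \<open>Squaring sends 1 and p - 1 to the same residue, so it is not injective on the finite set
  of residues and therefore misses some \<open>a\<close>.\<close>

lemma ex_quadratic_nonresidue:
  assumes "prime p" "p > (2::nat)"
  shows "\<exists>a. Legendre (int a) p = -1"
proof -
  have "\<not> inj_on (\<lambda>k. k ^ 2 mod p) {..<p}"
  proof
    assume "inj_on (\<lambda>k. k ^ 2 mod p) {..<p}"
    moreover have "(p - 1) ^ 2 mod p = 1 ^ 2 mod p"
    proof -
      obtain q where q: "p = 2 + q"
        using less_imp_add_positive[OF assms(2)] by metis
      have "(p - 1) ^ 2 = q * p + 1"
        unfolding q by (simp add: power2_eq_square)
      then show ?thesis
        by (simp only: mod_mult_self3 power_one)
    qed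
    moreover have "p - 1 \<in> {..<p}" "1 \<in> {..<p}"
      using assms by auto
    ultimately have "p - 1 = 1"
      by (rule inj_onD)
    then show False
      using assms by simp
  qed
  then have "\<not> {..<p} \<subseteq> (\<lambda>k. k ^ 2 mod p) ` {..<p}"
    by (metis finite_lessThan finite_surj_inj)
  then obtain a where a: "a < p" "\<And>k. k < p \<Longrightarrow> a \<noteq> k ^ 2 mod p"
    by blast
  have "\<not> QuadRes (int p) (int a)"
  proof
    assume "QuadRes (int p) (int a)"
    then obtain y where y: "[y ^ 2 = int a] (mod int p)"
      unfolding QuadRes_def by blast
    define k where "k = nat (y mod int p)"
    have k: "int k = y mod int p"
      using assms by (simp add: k_def)
    have "int (k ^ 2 mod p) = (y mod int p) ^ 2 mod int p"
      by (simp only: of_nat_mod of_nat_power k)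
    also have "\<dots> = y ^ 2 mod int p"
      by (rule power_mod)
    also have "\<dots> = int a"
      using y a(1) by (simp add: cong_def)
    finally have "k ^ 2 mod p = a"
      by (simp only: of_nat_eq_iff)
    moreover have "k < p"
      using assms by (simp add: k_def nat_less_iff)
    ultimately show False
      using a(2)[of k] by simp
  qed
  \<comment> \<open>Being a nonsquare gives the value -1 only if the symbol is not 0; the residue 0
    is itself a square.\<close>
  moreover have "a \<noteq> 0"
  proof
    assume "a = 0"
    then have "a = 0 ^ 2 mod p"
      by simp
    with a(2)[of 0] a(1) show False
      by simp
  qed
  then have "\<not> int p dvd int a"
    using a(1) dvd_imp_le[of p a] by auto
  ultimately have "Legendre (int a) p = -1"
    by (simp add: Legendre_def cong_0_iff)
  then show ?thesis ..
qed

section \<open>Gauss and Ramanujan sums\<close>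

text \<open>Multiplication by a nonresidue permutes the residues and changes the sign of every
  term.\<close>

lemma sum_Legendre:
  assumes "prime p" "p > (2::nat)"
  shows "(\<Sum>k<p. of_int (Legendre (int k) p) :: complex) = 0"
proof -
  obtain a where a: "Legendre (int a) p = -1"
    using ex_quadratic_nonresidue[OF assms] by blast
  have "\<not> p dvd a"
    using a Legendre_eq_0_iff[of "int a" "int p"] by (auto simp: int_dvd_int_iff)
  then have coprime: "coprime a p"
    using assms(1) by (metis coprime_commute prime_imp_coprime)
  let ?S = "\<Sum>k<p. of_int (Legendre (int k) p) :: complex"
  have "?S = (\<Sum>k<p. of_int (Legendre (int (a * k mod p)) p))"
    using assms by (intro sum.reindex_bij_betw[symmetric] bij_betw_mult_mod coprime) auto
  also have "\<dots> = (\<Sum>k<p. - of_int (Legendre (int k) p))"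
  proof (intro sum.cong refl)
    fix k
    have "Legendre (int (a * k mod p)) p = Legendre (int a * int k) p"
      by (rule Legendre_cong) (simp add: cong_def zmod_int)
    then show "of_int (Legendre (int (a * k mod p)) p) = - (of_int (Legendre (int k) p) :: complex)"
      using a by (simp add: Legendre_mult[OF assms])
  qed
  also have "\<dots> = - ?S"
    by (rule sum_negf)
  finally show ?thesis
    by simp
qed

text \<open>If \<open>p\<close> divides \<open>m\<close>, all exponentials are 1 and both sides
  vanish. Otherwise the substitution of \<open>m * k\<close> for \<open>k\<close> brings out the
  symbol of \<open>m\<close>, which is its own inverse.\<close>

lemma twisted_sum_Legendre:
  assumes "prime p" "p > (2::nat)"
  shows "twisted_sum (\<lambda>k. of_int (Legendre (int k) p)) p m =
    of_int (Legendre (int m) p) * twisted_sum (\<lambda>k. of_int (Legendre (int k) p)) p 1"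
proof (cases "p dvd m")
  case True
  have "unity_exp p (k * m) = 1" for k
    using True assms by (subst unity_exp_eq_1_iff) auto
  then show ?thesis
    using True sum_Legendre[OF assms] Legendre_eq_0_iff[of "int m" "int p"]
    by (simp add: twisted_sum_def)
next
  case False
  then have coprime: "coprime m p"
    using assms(1) by (metis coprime_commute prime_imp_coprime)
  have "Legendre (int m) p \<noteq> 0"
    using False Legendre_eq_0_iff[of "int m" "int p"] by simp
  then have sq: "Legendre (int m) p * Legendre (int m) p = 1"
    using Legendre_cases[of "int m" "int p"] by auto
  let ?f = "\<lambda>k. of_int (Legendre (int k) p) :: complex"
  have "twisted_sum ?f p 1 = (\<Sum>k<p. ?f (m * k) * unity_exp p (k * (m * 1)))"
  proof (rule twisted_sum_reindex_mult[OF coprime])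
    show "?f (k mod p) = ?f k" for k
      by (rule arg_cong[where f = of_int], rule Legendre_cong) (simp add: cong_def zmod_int)
  qed (use assms in auto)
  also have "\<dots> = ?f m * twisted_sum ?f p m"
    by (simp add: twisted_sum_def sum_distrib_left Legendre_mult[OF assms] mult.assoc)
  finally have "?f m * twisted_sum ?f p 1 = (?f m * ?f m) * twisted_sum ?f p m"
    by (simp only: mult.assoc)
  also have "?f m * ?f m = 1"
    by (simp only: sq of_int_1 flip: of_int_mult)
  finally show ?thesis
    by simp
qed

lemma sum_Legendre_squared:
  assumes "prime p" "p > (2::nat)"
  shows "(\<Sum>k<p. of_int (Legendre (int k) p) ^ 2 :: complex) = of_nat (p - 1)"
proof -
  have "(\<Sum>k<p. of_int (Legendre (int k) p) ^ 2 :: complex) = (\<Sum>k<p. if k = 0 then 0 else 1)"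
  proof (intro sum.cong refl)
    fix k assume "k \<in> {..<p}"
    then have "p dvd k \<longleftrightarrow> k = 0"
      by (auto dest: dvd_imp_le)
    then have "Legendre (int k) p = 0 \<longleftrightarrow> k = 0"
      by (simp add: Legendre_eq_0_iff)
    then show "of_int (Legendre (int k) p) ^ 2 = (if k = 0 then 0 else 1 :: complex)"
      using Legendre_cases[of "int k" "int p"] by auto
  qed
  also have "\<dots> = of_nat (card ({..<p} - {0}))"
    by (simp add: sum.If_cases set_diff_eq Int_def)
  also have "card ({..<p} - {0}) = p - 1"
    using assms by (subst card_Diff_singleton) auto
  finally show ?thesis .
qed

text \<open>The value of the squared Gauss sum comes from evaluating the sum of its squares over
  all frequencies in two ways.\<close>

lemma gauss_sum_prime_squared:
  assumes "prime p" "p > (2::nat)"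
  shows "twisted_sum (\<lambda>k. of_int (Legendre (int k) p)) p 1 ^ 2 = of_int (disc p)"
proof -
  let ?f = "\<lambda>k. of_int (Legendre (int k) p) :: complex"
  let ?g = "twisted_sum ?f p"
  have p0: "p > 0"
    using assms by simp
  have "of_nat (p - 1) * ?g 1 ^ 2 = (\<Sum>m<p. ?f m ^ 2) * ?g 1 ^ 2"
    by (simp only: sum_Legendre_squared[OF assms])
  also have "\<dots> = (\<Sum>m<p. (?f m * ?g 1) ^ 2)"
    by (simp only: sum_distrib_right power_mult_distrib)
  also have "\<dots> = (\<Sum>m<p. ?g m ^ 2)"
    by (simp only: twisted_sum_Legendre[OF assms, symmetric])
  also have "\<dots> = (\<Sum>m<p. \<Sum>k<p. \<Sum>l<p. ?f k * ?f l * unity_exp p (m * (k + l)))"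
    by (simp add: power2_eq_square twisted_sum_def sum_product unity_exp_add distrib_left mult_ac)
  also have "\<dots> = (\<Sum>k<p. \<Sum>m<p. \<Sum>l<p. ?f k * ?f l * unity_exp p (m * (k + l)))"
    by (rule sum.swap)
  also have "\<dots> = (\<Sum>k<p. \<Sum>l<p. \<Sum>m<p. ?f k * ?f l * unity_exp p (m * (k + l)))"
    by (intro sum.cong refl sum.swap)
  \<comment> \<open>Summing over the frequency \<open>m\<close> first leaves only pairs with k + l
    divisible by \<open>p\<close>, by orthogonality.\<close>
  also have "\<dots> = (\<Sum>k<p. \<Sum>l<p. ?f k * ?f l * (if p dvd k + l then of_nat p else 0))"
    by (simp only: sum_distrib_left[symmetric] sum_unity_exp[OF p0])
  also have "\<dots> = (\<Sum>k<p. ?f k ^ 2 * (of_int (Legendre (-1) p) * of_nat p))"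
  proof (intro sum.cong refl)
    fix k assume k: "k \<in> {..<p}"
    show "(\<Sum>l<p. ?f k * ?f l * (if p dvd k + l then of_nat p else 0)) =
      ?f k ^ 2 * (of_int (Legendre (-1) p) * of_nat p)"
    proof (cases "k = 0")
      case True
      then have "Legendre (int k) p = 0"
        by (simp add: Legendre_eq_0_iff)
      then show ?thesis
        by (simp only: of_int_0 mult_zero_left sum.neutral_const power2_eq_square)
    next
      case False
      \<comment> \<open>Since 0 < k + l < 2p, the only possible multiple of \<open>p\<close> is
        \<open>p\<close> itself.\<close>
      have iff: "p dvd k + l \<longleftrightarrow> l = p - k" if "l < p" for l
      proof
        assume "p dvd k + l"
        then obtain q where q: "k + l = p * q" ..
        have "p * q < p * 2" "0 < p * q"
          unfolding q[symmetric] using k False that by auto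
        then have "q = 1"
          by simp
        then show "l = p - k"
          using q by simp
      qed (use k in simp)
      have "(\<Sum>l<p. ?f k * ?f l * (if p dvd k + l then of_nat p else 0)) =
        (\<Sum>l<p. if l = p - k then ?f k * ?f (p - k) * of_nat p else 0)"
        using iff by (intro sum.cong refl) auto
      also have "\<dots> = ?f k * ?f (p - k) * of_nat p"
        using k False by simp
      also have "Legendre (int (p - k)) p = Legendre (-1 * int k) p"
        using k by (intro Legendre_cong) (auto simp: cong_iff_dvd_diff of_nat_diff)
      finally show ?thesis
        by (simp add: Legendre_mult[OF assms] power2_eq_square del: mult_minus1 mult_minus_left)
    qed
  qed
  also have "\<dots> = (\<Sum>k<p. ?f k ^ 2) * (of_int (Legendre (-1) p) * of_nat p)"
    by (simp only: sum_distrib_right)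
  also have "\<dots> = of_nat (p - 1) * of_int (disc p)"
    by (simp add: sum_Legendre_squared[OF assms] Legendre_minus_1[OF assms] disc_def)
  finally have "(of_nat (p - 1) :: complex) * ?g 1 ^ 2 = of_nat (p - 1) * of_int (disc p)" .
  moreover have "(of_nat (p - 1) :: complex) \<noteq> 0"
    using assms by simp
  ultimately show ?thesis
    by (simp only: mult_cancel_left simp_thms)
qed

text \<open>The squared symbol is the indicator of nonzero residues, so this is the full exponential
  sum minus its term at 0.\<close>

lemma twisted_sum_Legendre_squared_prime:
  assumes "prime p" "p > (2::nat)"
  shows "twisted_sum (\<lambda>k. of_int (Legendre (int k) p) ^ 2) p m =
    (if p dvd m then of_nat (p - 1) else -1)"
proof -
  have p0: "p > 0"
    using assms by simp
  have "twisted_sum (\<lambda>k. of_int (Legendre (int k) p) ^ 2) p m =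
      (\<Sum>k<p. unity_exp p (k * m) - (if k = 0 then 1 else 0))"
    unfolding twisted_sum_def
  proof (intro sum.cong refl)
    fix k assume "k \<in> {..<p}"
    then have "p dvd k \<longleftrightarrow> k = 0"
      by (auto dest: dvd_imp_le)
    then have "Legendre (int k) p = 0 \<longleftrightarrow> k = 0"
      by (simp add: Legendre_eq_0_iff)
    then show "of_int (Legendre (int k) p) ^ 2 * unity_exp p (k * m) =
        unity_exp p (k * m) - (if k = 0 then 1 else 0)"
      using Legendre_cases[of "int k" "int p"] by auto
  qed
  also have "\<dots> = (if p dvd m then of_nat p else 0) - 1"
    using p0 by (simp add: sum_subtractf sum_unity_exp)
  finally show ?thesis
    using p0 by (simp add: of_nat_diff Suc_le_eq)
qed

section \<open>Jacobi symbols and passage to squarefree moduli\<close>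

lemma jacobi_1 [simp]: "jacobi a (Suc 0) = 1"
  by (simp add: jacobi_def)

lemma jacobi_prime_mult:
  assumes "prime p" "n > 0"
  shows "jacobi a (p * n) = Legendre a p * jacobi a n"
proof -
  have "prime_factorization (p * n) = add_mset p (prime_factorization n)"
    using assms by (subst prime_factorization_mult) (auto simp: prime_factorization_prime)
  then show ?thesis
    by (simp add: jacobi_def)
qed

lemma jacobi_cases: "jacobi a n = 0 \<or> jacobi a n = 1 \<or> jacobi a n = -1"
proof (cases "n = 0")
  case False
  then show ?thesis
  proof (induction n rule: prime_divisors_induct)
    case (factor p n)
    then show ?case
      using jacobi_prime_mult[of p n a] Legendre_cases[of a p] by (cases "n = 0") auto
  qed (auto simp: jacobi_def)
qed (simp add: jacobi_def)

lemma jacobi_cong: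
  assumes "[a = b] (mod int n)"
  shows "jacobi a n = jacobi b n"
  unfolding jacobi_def
proof (intro arg_cong[where f = prod_mset] image_mset_cong Legendre_cong)
  fix p assume "p \<in># prime_factorization n"
  then show "[a = b] (mod int p)"
    using assms by (meson cong_dvd_modulus in_prime_factors_iff int_dvd_int_iff)
qed

text \<open>For a = 2i + 1 and b = 2j + 1, the exponent (ab - 1)/2 = 2ij + i + j has the parity of i
  + j.\<close>

lemma disc_mult:
  assumes "odd a" "odd b"
  shows "disc (a * b) = disc a * disc b"
proof -
  obtain i j where ij: "a = 2 * i + 1" "b = 2 * j + 1"
    using assms by (auto elim!: oddE)
  have "(a * b - 1) div 2 = 2 * (i * j) + i + j"
    unfolding ij by (simp add: algebra_simps)
  then have "(-1 :: int) ^ ((a * b - 1) div 2) = (-1) ^ i * (-1) ^ j"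
    by (simp add: power_add power_mult)
  moreover have "(a - 1) div 2 = i" "(b - 1) div 2 = j"
    unfolding ij by simp_all
  ultimately show ?thesis
    by (simp only: disc_def of_nat_mult mult_ac)
qed

lemma jacobi_mult:
  assumes "odd n"
  shows "jacobi (a * b) n = jacobi a n * jacobi b n"
proof -
  have "Legendre (a * b) p = Legendre a p * Legendre b p" if "p \<in># prime_factorization n" for p
  proof (rule Legendre_mult)
    show p: "prime p"
      using that by (rule in_prime_factors_imp_prime)
    moreover have "p \<noteq> 2"
      using assms that by (auto dest: in_prime_factors_imp_dvd)
    ultimately show "p > 2"
      using prime_ge_2_nat[of p] by linarith
  qed
  then have "jacobi (a * b) n = (\<Prod>p\<in>#prime_factorization n. Legendre a (int p) * Legendre b (int p))"
    unfolding jacobi_def by (intro arg_cong[where f = prod_mset] image_mset_cong) auto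
  then show ?thesis
    by (simp add: jacobi_def prod_mset.distrib)
qed

lemma jacobi_nonzero:
  assumes "coprime a (int n)"
  shows "jacobi a n \<noteq> 0"
proof
  assume "jacobi a n = 0"
  then obtain p where p: "p \<in># prime_factorization n" "Legendre a (int p) = 0"
    unfolding jacobi_def by auto
  then have "int p dvd a" "int p dvd int n"
    using in_prime_factors_imp_dvd[of p n] by (auto simp: Legendre_eq_0_iff)
  then have "int p dvd 1"
    using assms by (meson coprime_common_divisor)
  then show False
    using in_prime_factors_imp_prime[OF p(1)] by simp
qed

lemma twisted_sum_scale: "twisted_sum (\<lambda>k. f k * c) d m = c * twisted_sum f d m"
  by (simp add: twisted_sum_def sum_distrib_left mult_ac)

lemma squarefree_mult_imp_coprime:
  fixes a b :: "'a :: semiring_gcd"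
  assumes "squarefree (a * b)"
  shows "coprime a b"
proof (rule coprimeI)
  fix c assume "c dvd a" "c dvd b"
  then have "c ^ 2 dvd a * b"
    by (simp add: power2_eq_square mult_dvd_mono)
  then show "is_unit c"
    using assms by (rule squarefreeD[rotated])
qed

lemma gcd_mult_coprime_left:
  fixes a b m :: nat
  assumes "coprime a b"
  shows "gcd (a * b) m = gcd a m * gcd b m"
proof (rule dvd_antisym)
  obtain x y where xy: "gcd (a * b) m = x * y" "x dvd a" "y dvd b"
    using dvd_productE[of "gcd (a * b) m" a b] by (metis gcd_dvd1)
  then have "x dvd m" "y dvd m"
    by (metis dvd_mult_left dvd_mult_right gcd_dvd2)+
  then show "gcd (a * b) m dvd gcd a m * gcd b m"
    unfolding xy(1) using xy(2,3) by (intro mult_dvd_mono gcd_greatest)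
  have "coprime (gcd a m) (gcd b m)"
    using assms by (meson coprime_divisors gcd_dvd1)
  then have "gcd a m * gcd b m dvd m"
    by (intro divides_mult) auto
  then show "gcd a m * gcd b m dvd gcd (a * b) m"
    by (intro gcd_greatest mult_dvd_mono) auto
qed

abbreviation jacobi_sum :: "nat \<Rightarrow> nat \<Rightarrow> complex" where
  "jacobi_sum d m \<equiv> twisted_sum (\<lambda>k. of_int (jacobi (int k) d)) d m"

abbreviation jacobi_squared_sum :: "nat \<Rightarrow> nat \<Rightarrow> complex" where
  "jacobi_squared_sum d m \<equiv> twisted_sum (\<lambda>k. of_int (jacobi (int k) d) ^ 2) d m"

text \<open>The exponent \<open>e\<close> treats Gauss sums (e = 1) and Ramanujan sums (e = 2)
  together. The factor in front arises from the multipliers \<open>n\<close> modulo \<open>p\<close>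
  and \<open>p\<close> modulo \<open>n\<close> in the Chinese remainder parametrisation.\<close>

lemma jacobi_sum_power_mult_prime:
  assumes "prime p" "p > 2" "odd n" "coprime p n"
  shows "twisted_sum (\<lambda>k. of_int (jacobi (int k) (p * n)) ^ e) (p * n) m =
    of_int (Legendre (int n) p * jacobi (int p) n) ^ e *
      (twisted_sum (\<lambda>k. of_int (Legendre (int k) p) ^ e) p m *
       twisted_sum (\<lambda>k. of_int (jacobi (int k) n) ^ e) n m)"
proof -
  have n: "n > 0" and p: "p > 0"
    using assms by (auto intro: Nat.gr0I)
  let ?f = "\<lambda>k. of_int (Legendre (int k) p) ^ e :: complex"
  let ?g = "\<lambda>k. of_int (jacobi (int k) n) ^ e :: complex"
  have "(\<lambda>k. of_int (jacobi (int k) (p * n)) ^ e) = (\<lambda>k. ?f k * ?g k)"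
    by (simp add: jacobi_prime_mult[OF assms(1) n] power_mult_distrib)
  moreover have "twisted_sum (\<lambda>k. ?f k * ?g k) (p * n) m =
      twisted_sum (\<lambda>k. ?f (k * n)) p m * twisted_sum (\<lambda>k. ?g (k * p)) n m"
  proof (rule twisted_sum_mult_coprime[OF assms(4) p n])
    show "?f j = ?f k" if "[j = k] (mod p)" for j k
      using that Legendre_cong[of "int j" "int k" "int p"] by (simp add: cong_int_iff)
    show "?g j = ?g k" if "[j = k] (mod n)" for j k
      using that jacobi_cong[of "int j" "int k" n] by (simp add: cong_int_iff)
  qed
  moreover have "(\<lambda>k. ?f (k * n)) = (\<lambda>k. ?f k * ?f n)"
    by (simp add: Legendre_mult[OF assms(1,2)] power_mult_distrib)
  moreover have "(\<lambda>k. ?g (k * p)) = (\<lambda>k. ?g k * ?g p)"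
    by (simp add: jacobi_mult[OF assms(3)] power_mult_distrib)
  ultimately show ?thesis
    by (simp add: twisted_sum_scale power_mult_distrib mult_ac)
qed

text \<open>Both parts follow by induction over the prime factors. The factor in front is a sign,
  which disappears for e = 2 and, after squaring the sum, for e = 1; so neither quadratic
  reciprocity nor the sign of the Gauss sum enters.\<close>

lemma jacobi_sums:
  assumes "odd d" "squarefree d"
  shows jacobi_squared_sum_eq:
      "jacobi_squared_sum d m = of_nat (totient (gcd d m)) \<or>
       jacobi_squared_sum d m = - of_nat (totient (gcd d m))"
    and jacobi_sum_squared_eq: "jacobi_sum d m ^ 2 = (if coprime d m then of_int (disc d) else 0)"
proof -
  have "(jacobi_squared_sum d m = of_nat (totient (gcd d m)) \<or>
       jacobi_squared_sum d m = - of_nat (totient (gcd d m))) \<and>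
     jacobi_sum d m ^ 2 = (if coprime d m then of_int (disc d) else 0)"
    using assms
  proof (induction d rule: prime_divisors_induct)
    case zero
    then show ?case
      by simp
  next
    case (unit d)
    then show ?case
      by (simp add: twisted_sum_def disc_def)
  next
    case (factor p n)
    have p: "prime p" "p > 2" and n: "odd n" "squarefree n" and coprime: "coprime p n"
    proof -
      show "prime p" "odd n"
        using factor by auto
      then show "p > 2"
        using factor prime_ge_2_nat[of p] by (cases "p = 2") auto
      show "squarefree n" "coprime p n"
        using factor.prems(2) by (rule squarefree_multD, rule squarefree_mult_imp_coprime)
    qed
    let ?u = "Legendre (int n) p * jacobi (int p) n"
    have "\<not> p dvd n"
      using coprime p(1) by (metis coprime_absorb_left not_prime_unit)
    then have "Legendre (int n) p \<noteq> 0"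
      by (simp add: Legendre_eq_0_iff)
    moreover have "jacobi (int p) n \<noteq> 0"
      using coprime by (intro jacobi_nonzero) simp
    ultimately have u: "?u ^ 2 = 1"
      using Legendre_cases[of "int n" "int p"] jacobi_cases[of "int p" n] by (auto simp: power_mult_distrib)
    have u': "(of_int ?u :: complex) ^ 2 = 1"
      using u by (metis of_int_1 of_int_power)
    have gcd: "gcd (p * n) m = gcd p m * gcd n m"
      using coprime by (rule gcd_mult_coprime_left)
    have "coprime (gcd p m) (gcd n m)"
      using coprime by (meson coprime_divisors gcd_dvd1)
    then have totient: "totient (gcd (p * n) m) = totient (gcd p m) * totient (gcd n m)"
      unfolding gcd by (rule totient_mult_coprime)
    have IH: "jacobi_squared_sum n m = of_nat (totient (gcd n m)) \<or>
       jacobi_squared_sum n m = - of_nat (totient (gcd n m))"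
      "jacobi_sum n m ^ 2 = (if coprime n m then of_int (disc n) else 0)"
      using factor.IH n by auto
    have "jacobi_squared_sum (p * n) m =
        twisted_sum (\<lambda>k. of_int (Legendre (int k) p) ^ 2) p m * jacobi_squared_sum n m"
      using jacobi_sum_power_mult_prime[OF p n(1) coprime, of 2 m] u' by simp
    moreover have "twisted_sum (\<lambda>k. of_int (Legendre (int k) p) ^ 2) p m = of_nat (totient (gcd p m)) \<or>
        twisted_sum (\<lambda>k. of_int (Legendre (int k) p) ^ 2) p m = - of_nat (totient (gcd p m))"
    proof (cases "p dvd m")
      case True
      then have "gcd p m = p"
        by (simp add: gcd_nat.absorb1)
      then show ?thesis
        using True p by (simp add: twisted_sum_Legendre_squared_prime totient_prime)
    next
      case False
      then have "gcd p m = 1"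
        using p(1) by (metis coprime_iff_gcd_eq_1 prime_imp_coprime)
      then show ?thesis
        using False p by (simp add: twisted_sum_Legendre_squared_prime)
    qed
    ultimately have "jacobi_squared_sum (p * n) m = of_nat (totient (gcd (p * n) m)) \<or>
       jacobi_squared_sum (p * n) m = - of_nat (totient (gcd (p * n) m))"
      unfolding totient using IH(1) by auto
    moreover have "jacobi_sum (p * n) m ^ 2 =
      twisted_sum (\<lambda>k. of_int (Legendre (int k) p)) p m ^ 2 * jacobi_sum n m ^ 2"
      using jacobi_sum_power_mult_prime[OF p n(1) coprime, of 1 m] u'
      by (simp add: power_mult_distrib)
    moreover have "twisted_sum (\<lambda>k. of_int (Legendre (int k) p)) p m ^ 2 =
        (if coprime p m then of_int (disc p) else 0)"
    proof (cases "p dvd m")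
      case True
      then have "Legendre (int m) p = 0" "\<not> coprime p m"
        using p(1) by (auto simp: Legendre_eq_0_iff coprime_absorb_left)
      then show ?thesis
        using twisted_sum_Legendre[OF p, of m] by simp
    next
      case False
      then have "coprime p m"
        using p(1) by (simp add: prime_imp_coprime)
      moreover have "Legendre (int m) p ^ 2 = 1"
        using False Legendre_cases[of "int m" "int p"] Legendre_eq_0_iff[of "int m" "int p"] by auto
      then have "(of_int (Legendre (int m) p) :: complex) ^ 2 = 1"
        by (metis of_int_1 of_int_power)
      ultimately show ?thesis
        using twisted_sum_Legendre[OF p, of m] gauss_sum_prime_squared[OF p]
        by (simp add: power_mult_distrib)
    qed
    moreover have "odd p"
      using p prime_odd_nat by blast
    then have "disc (p * n) = disc p * disc n"
      using n(1) by (rule disc_mult)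
    ultimately show ?case
      using IH(2) by auto
  qed
  then show "jacobi_squared_sum d m = of_nat (totient (gcd d m)) \<or>
       jacobi_squared_sum d m = - of_nat (totient (gcd d m))"
    "jacobi_sum d m ^ 2 = (if coprime d m then of_int (disc d) else 0)"
    by blast+
qed

section \<open>The coefficient bound\<close>

definition jacobi_class :: "int \<Rightarrow> nat \<Rightarrow> nat set" where
  "jacobi_class s d = {k \<in> {1..d}. jacobi (int k) d = s}"

lemma finite_jacobi_class [simp]: "finite (jacobi_class s d)"
  by (simp add: jacobi_class_def)

lemma U_poly_eq: "U_poly s d = (\<Prod>k\<in>jacobi_class s d. [:- unity_exp d k, 1:])"
  unfolding U_poly_def jacobi_class_def unity_exp_def cis_conv_exp
  by (intro prod.cong refl) (auto simp: mult_ac)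

text \<open>For J in {-1, 0, 1} the indicator of J = s is (J^2 + sJ)/2.\<close>

lemma sum_unity_exp_jacobi_class:
  assumes "d > 0" "s = 1 \<or> s = -1"
  shows "(\<Sum>k\<in>jacobi_class s d. unity_exp d k ^ m) =
    (jacobi_squared_sum d m + of_int s * jacobi_sum d m) / 2"
proof -
  let ?J = "\<lambda>k. of_int (jacobi (int k) d) :: complex"
  define h where "h k = (?J k ^ 2 + of_int s * ?J k) / 2 * unity_exp d (k * m)" for k
  have "(\<Sum>k\<in>jacobi_class s d. unity_exp d k ^ m) =
      (\<Sum>k\<in>{1..d}. if jacobi (int k) d = s then unity_exp d (k * m) else 0)"
    unfolding jacobi_class_def unity_exp_power by (rule sum.inter_filter) simp
  also have "\<dots> = (\<Sum>k\<in>{1..d}. h k)"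
  proof (intro sum.cong refl)
    fix k
    show "(if jacobi (int k) d = s then unity_exp d (k * m) else 0) = h k"
      using jacobi_cases[of "int k" d] assms(2) by (auto simp: h_def)
  qed
  also have "{1..d} = insert d {1..<d}"
    using assms(1) by auto
  also have "(\<Sum>k\<in>insert d {1..<d}. h k) = h d + (\<Sum>k\<in>{1..<d}. h k)"
    by simp
  \<comment> \<open>The class is indexed by 1, ..., d and \<open>twisted_sum\<close> by 0, ..., d -
    1; periodicity identifies the two end terms.\<close>
  also have "h d = h 0"
  proof -
    have "jacobi (int d) d = jacobi (int 0) d"
      by (rule jacobi_cong) (simp add: cong_def)
    then show ?thesis
      using assms(1) by (simp add: h_def)
  qed
  also have "h 0 + (\<Sum>k\<in>{1..<d}. h k) = (\<Sum>k\<in>insert 0 {1..<d}. h k)"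
    by simp
  also have "insert 0 {1..<d} = {..<d}"
    using assms(1) by auto
  also have "(\<Sum>k<d. h k) =
      (\<Sum>k<d. (?J k ^ 2 * unity_exp d (k * m) + of_int s * (?J k * unity_exp d (k * m))) / 2)"
    by (simp add: h_def algebra_simps)
  also have "\<dots> = (jacobi_squared_sum d m + of_int s * jacobi_sum d m) / 2"
    by (simp only: twisted_sum_def sum_divide_distrib[symmetric] sum.distrib sum_distrib_left)
  finally show ?thesis .
qed

text \<open>The power sum for m = 0 counts the class. The Gauss sum vanishes there because gcd(d, 0)
  = d > 1, and taking norms removes the undetermined sign of the Ramanujan sum.\<close>

lemma card_jacobi_class:
  assumes "d > 1" "odd d" "squarefree d" "s = 1 \<or> s = -1"
  shows "card (jacobi_class s d) = half_totient d"
proof -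
  have "jacobi_sum d 0 = 0"
    using jacobi_sum_squared_eq[OF assms(2,3), of 0] assms(1) by simp
  then have "2 * of_nat (card (jacobi_class s d)) = jacobi_squared_sum d 0"
    using sum_unity_exp_jacobi_class[of d s 0] assms(1,4) by (simp add: mult.commute)
  then have "norm (2 * of_nat (card (jacobi_class s d)) :: complex) = norm (jacobi_squared_sum d 0)"
    by (rule arg_cong)
  also have "\<dots> = real (totient d)"
    using jacobi_squared_sum_eq[OF assms(2,3), of 0] by auto
  also have "norm (2 * of_nat (card (jacobi_class s d)) :: complex) = real (2 * card (jacobi_class s d))"
    by (simp add: norm_mult)
  finally have "2 * card (jacobi_class s d) = totient d"
    by (simp only: of_nat_eq_iff)
  then show ?thesis
    by (simp add: half_totient_def)
qed

section \<open>Bounding the power sums by \<open>F_max\<close>\<close>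

lemma Re_sqrt_disc_nonneg: "Re (sqrt_disc d) \<ge> 0"
  by (simp add: sqrt_disc_def)

lemma norm_one_plus_sqrt_disc_gt_2:
  assumes "d \<ge> 5"
  shows "cmod (1 + sqrt_disc d) > 2"
proof (cases "d mod 4 = 1")
  case True
  have "1 < sqrt (real d)"
    using assms by simp
  then have "norm (complex_of_real (1 + sqrt (real d))) > 2"
    unfolding norm_of_real by linarith
  then show ?thesis
    using True by (simp add: sqrt_disc_def)
next
  case False
  have "sqrt 4 < sqrt (1 + real d)"
    using assms by (intro real_sqrt_less_mono) simp
  then show ?thesis
    using False by (simp add: sqrt_disc_def cmod_def)
qed

lemma norm_one_minus_le_one_plus:
  assumes "Re w \<ge> 0"
  shows "cmod (1 - w) \<le> cmod (1 + w)"
  unfolding cmod_def using assms by (intro real_sqrt_le_mono) (simp add: power2_eq_square algebra_simps)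

text \<open>Whatever the signs, the norm is |1 + w| or |1 - w|, and the former is the larger one as
  Re w \<ge> 0. This is why \<open>F_max\<close> can do without the sign of the Gauss sum.\<close>

lemma norm_signed_sum_le_one_plus:
  assumes "s = 1 \<or> s = -1" "u = w \<or> u = - w" "c = 1 \<or> c = -1" "Re w \<ge> 0"
  shows "cmod (c + of_int s * u) \<le> cmod (1 + w)"
proof -
  have "c + of_int s * u \<in> {1 + w, 1 - w, - (1 - w), - (1 + w)}"
    using assms(1-3) by (elim disjE) simp_all
  then have "cmod (c + of_int s * u) = cmod (1 + w) \<or> cmod (c + of_int s * u) = cmod (1 - w)"
    by (elim insertE emptyE) (simp_all only: norm_minus_cancel simp_thms)
  then show ?thesis
    using norm_one_minus_le_one_plus[OF assms(4)] by linarith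
qed

lemma finite_F_max_set:
  "finite ({real (totient f) / 2 | f. f dvd d \<and> 1 < f \<and> f \<le> n} \<union> {c})"
proof -
  have "finite {f. f dvd d \<and> 1 < f \<and> f \<le> n}"
    by (rule finite_subset[of _ "{..n}"]) auto
  then show ?thesis
    by (intro finite_UnI finite_image_set) simp_all
qed

text \<open>If \<open>m\<close> is coprime to \<open>d\<close>, the norm is at most |1 +
  \<surd>D|/2. Otherwise the Gauss sum vanishes and f = gcd(d, m) satisfies 1 < f \<le> m \<le> n,
  so the norm is one of the totient entries of the maximum.\<close>

lemma norm_sum_unity_exp_jacobi_class_le:
  assumes "d \<ge> 5" "odd d" "squarefree d" "s = 1 \<or> s = -1" "1 \<le> m" "m \<le> n"
  shows "cmod (\<Sum>k\<in>jacobi_class s d. unity_exp d k ^ m) \<le> F_max d n"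
proof -
  let ?S = "{real (totient f) / 2 | f. f dvd d \<and> 1 < f \<and> f \<le> n} \<union> {cmod (1 + sqrt_disc d) / 2}"
  have sum: "(\<Sum>k\<in>jacobi_class s d. unity_exp d k ^ m) =
      (jacobi_squared_sum d m + of_int s * jacobi_sum d m) / 2"
    using assms by (intro sum_unity_exp_jacobi_class) auto
  show ?thesis
  proof (cases "coprime d m")
    case True
    let ?w = "sqrt_disc d"
    have "jacobi_sum d m ^ 2 = ?w ^ 2"
      using jacobi_sum_squared_eq[OF assms(2,3), of m] True sqrt_disc_squared[OF assms(2)] by simp
    then have "jacobi_sum d m = ?w \<or> jacobi_sum d m = - ?w"
      by (simp only: power2_eq_iff)
    moreover have "jacobi_squared_sum d m = 1 \<or> jacobi_squared_sum d m = -1"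
      using jacobi_squared_sum_eq[OF assms(2,3), of m] True by simp
    ultimately have "cmod (jacobi_squared_sum d m + of_int s * jacobi_sum d m) \<le> cmod (1 + ?w)"
      using assms(4) Re_sqrt_disc_nonneg by (intro norm_signed_sum_le_one_plus)
    then have "cmod (\<Sum>k\<in>jacobi_class s d. unity_exp d k ^ m) \<le> cmod (1 + ?w) / 2"
      unfolding sum by (simp add: norm_divide)
    also have "\<dots> \<le> F_max d n"
      unfolding F_max_def by (rule Max_ge[OF finite_F_max_set]) simp
    finally show ?thesis .
  next
    case False
    have J: "jacobi_sum d m = 0"
      using jacobi_sum_squared_eq[OF assms(2,3), of m] False by simp
    have "cmod (jacobi_squared_sum d m) = real (totient (gcd d m))"
      using jacobi_squared_sum_eq[OF assms(2,3), of m] by auto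
    then have "cmod (\<Sum>k\<in>jacobi_class s d. unity_exp d k ^ m) = real (totient (gcd d m)) / 2"
      unfolding sum J by (simp add: norm_divide)
    also have "\<dots> \<le> F_max d n"
      unfolding F_max_def
    proof (rule Max_ge[OF finite_F_max_set])
      have "gcd d m \<noteq> 0" "gcd d m \<noteq> 1"
        using False assms(1) by (simp, metis coprime_iff_gcd_eq_1)
      then have "1 < gcd d m"
        by linarith
      moreover have "gcd d m \<le> n"
        using assms(5,6) gcd_le2_nat[of m d] by linarith
      ultimately show "real (totient (gcd d m)) / 2 \<in> ?S"
        by blast
    qed
    finally show ?thesis .
  qed
qed

lemma F_max_gt_1:
  assumes "d \<ge> 5"
  shows "F_max d n > 1"
proof -
  have "cmod (1 + sqrt_disc d) / 2 \<le> F_max d n"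
    unfolding F_max_def by (rule Max_ge[OF finite_F_max_set]) simp
  then show ?thesis
    using norm_one_plus_sqrt_disc_gt_2[OF assms] by simp
qed

lemma coeff_U_poly_eq:
  assumes "d > 1" "odd d" "squarefree d" "s = 1 \<or> s = -1" "n \<le> half_totient d"
  shows "poly.coeff (U_poly s d) (half_totient d - n) =
    poly.coeff (\<Prod>k\<in>jacobi_class s d. [:1, - unity_exp d k:]) n"
  using coeff_prod_linear_eq_coeff_reflected[of "jacobi_class s d" n "unity_exp d"] assms
  by (simp add: card_jacobi_class U_poly_eq)

text \<open>Dividing by \<surd>D in \<open>Xi_poly\<close> and multiplying back gives (U^+ + U^-) +
  (U^- - U^+) = 2 U^-.\<close>

lemma coeff_sum_eq:
  assumes "d \<ge> 5" "odd d" "squarefree d" "n \<le> half_totient d"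
  shows "a_coeff d n + b_coeff d n * sqrt_disc d = 2 * poly.coeff (U_poly (-1) d) (half_totient d - n)"
proof (cases "n = 0")
  case True
  \<comment> \<open>For n = 0 the coefficient \<open>b_coeff\<close> is 0 by convention; both
    polynomials are monic of the same degree, so each side equals 2.\<close>
  have "poly.coeff (U_poly s d) (half_totient d) = 1" if "s = 1 \<or> s = -1" for s
    using coeff_U_poly_eq[of d s 0] assms that
    by (simp add: poly_0_coeff_0[symmetric] poly_prod)
  then show ?thesis
    using True by (simp add: a_coeff_def b_coeff_def Psi_poly_def)
next
  case False
  have "sqrt_disc d \<noteq> 0"
    using assms(1) by (auto simp: sqrt_disc_def)
  then show ?thesis
    using False by (simp add: a_coeff_def b_coeff_def Psi_poly_def Xi_poly_def)
qed

theorem mainTheorem2: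
  fixes d n :: nat and F :: real
  assumes "d \<ge> 5" and "odd d" and "squarefree d"
    and "n \<le> half_totient d"
  defines "F \<equiv> F_max d n"
  shows "ereal (cmod (a_coeff d n + b_coeff d n * sqrt_disc d)) <
    Min {if n = 0 then \<infinity>
           else ereal (sqrt (2 * exp (1 / (6 * (F + real n))) / (exp 1 * pi * real n)) *
                  (exp 1 * (F + real n - 1) / (F - 1)) powr (F - 1 / 2)),
         if n = 0 then \<infinity>
           else ereal (sqrt (2 * exp (1 / (6 * (F + real n))) / (exp 1 * pi * (F - 1))) *
                  (exp 1 * (F + real n - 1) / real n) powr (real n + 1 / 2)),
         ereal (2 powr (F + real n))}"
proof -
  define c where "c = cmod (a_coeff d n + b_coeff d n * sqrt_disc d)"
  define B where "B = pochhammer F n / fact n"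
  have F: "F > 1"
    unfolding F_def using assms(1) by (rule F_max_gt_1)
  have "c = 2 * cmod (poly.coeff (U_poly (-1) d) (half_totient d - n))"
    unfolding c_def by (subst coeff_sum_eq[OF assms(1-4)]) (simp add: norm_mult)
  also have "poly.coeff (U_poly (-1) d) (half_totient d - n) =
      poly.coeff (\<Prod>k\<in>jacobi_class (-1) d. [:1, - unity_exp d k:]) n"
    using assms by (intro coeff_U_poly_eq) auto
  also have "cmod \<dots> \<le> B"
    unfolding B_def F_def using assms
    by (intro norm_coeff_le_of_power_sum_le norm_sum_unity_exp_jacobi_class_le) auto
  finally have c: "c \<le> 2 * B"
    by simp
  \<comment> \<open>The -1 in the exponent absorbs the factor 2 in
    \<open>c \<le> 2 * B\<close>.\<close>
  have "B < 2 powr (F + real n - 1)"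
    unfolding B_def using F by (rule pochhammer_over_fact_less_power)
  also have "\<dots> = 2 powr (F + real n) / 2"
    by (simp add: powr_diff)
  finally have power: "c < 2 powr (F + real n)"
    using c by simp
  \<comment> \<open>The Stirling-type bound is used with G = F - 1, positive because F > 1, and E =
    1/(6(F + n)); the two choices of \<open>x\<close> and \<open>y\<close> yield the first two
    entries of the minimum.\<close>
  have *: "c < sqrt (2 * exp (1 / (6 * (F + real n))) / (exp 1 * pi * x)) *
      (exp 1 * (F + real n - 1) / y) powr (y + 1 / 2)"
    if "n > 0" "{x, y} = {F - 1, real n}" for x y
  proof -
    have "2 * (pochhammer (F - 1 + 1) n / fact n) <
      sqrt (2 * exp (1 / (6 * (F + real n))) / (exp 1 * pi * x)) *
        (exp 1 * (F - 1 + real n) / y) powr (y + 1 / 2)"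
      using F that by (intro pochhammer_over_fact_less_stirling) auto
    moreover have "F - 1 + 1 = F" "F - 1 + real n = F + real n - 1" "F - 1 + 1 / 2 = F - 1 / 2"
      by auto
    ultimately show ?thesis
      using c by (simp only: B_def)
  qed
  have "c < sqrt (2 * exp (1 / (6 * (F + real n))) / (exp 1 * pi * real n)) *
      (exp 1 * (F + real n - 1) / (F - 1)) powr (F - 1 / 2)"
    and "c < sqrt (2 * exp (1 / (6 * (F + real n))) / (exp 1 * pi * (F - 1))) *
      (exp 1 * (F + real n - 1) / real n) powr (real n + 1 / 2)" if "n > 0"
    using *[OF that, of "real n" "F - 1"] *[OF that, of "F - 1" "real n"]
    by (simp_all add: insert_commute)
  then show ?thesis
    unfolding c_def[symmetric] using power by auto
qed

end
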